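(* Suppose that Assumption 1 (stated in the context) holds for $\mathbf v\in\mathbb C^N$ and $\mathbf M_0\in\mathbb H^N$, let $\hat{\boldsymbol\mu}\in\mathcal D(\mathbf v)$ be an arbitrary dual SDP certificate for $\mathbf v$, let $\rho>0$ satisfy $\rho\ge\max_{j\in\mathcal M}|\sigma_j\hat\mu_j|$, and let $\lambda$ be the second smallest eigenvalue of $\mathbf H(\hat{\boldsymbol\mu})$. Suppose that the noise $\boldsymbol\eta$ is a zero-mean Gaussian vector with covariance matrix $\boldsymbol\Sigma=\mathrm{diag}(\sigma_1^2,\dots,\sigma_M^2)$. Let $z_j=\mathbf v^*\mathbf M_j\mathbf v+\eta_j$, and let $(\mathbf X^{\mathrm{opt}},\boldsymbol\nu^{\mathrm{opt}})$ be an optimal solution of $$\min_{\mathbf X\in\mathbb H^N,\ \boldsymbol\nu\in\mathbb R^M}\ \rho f_{\mathrm{WLAV}}(\boldsymbol\nu)+\mathrm{Tr}(\mathbf M_0\mathbf X)\quad\text{subject to}\quad \mathrm{Tr}(\mathbf M_j\mathbf X)+\nu_j=z_j\ \ \forall j\in\mathcal M,\quad \mathbf X\succeq\mathbf 0.$$ Let $\zeta=\|\mathbf X^{\mathrm{opt}}-\beta\mathbf v\mathbf v^*\|_F/\sqrt{N\times\mathrm{Tr}(\mathbf X^{\mathrm{opt}})}$ be the estimation error, where $\beta>0$ is a scalar (depending on the noise realization) for which $\zeta\le 2\sqrt{\rho f_{\mathrm{WLAV}}(\boldsymbol\eta)/(N\lambda)}$. Then the tail probability of $\zeta$ is bounded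 as $$\mathbb P(\zeta>t)\le e^{-\gamma M}\qquad\text{for every } t>0,$$ where $\gamma=\dfrac{t^4\lambda^2}{32\kappa^2\rho^2}-\ln 2$ and $\kappa=\dfrac MN$.
   Context: $\mathbb H^N$ denotes the $N\times N$ complex Hermitian matrices ($N\ge2$), $(\cdot)^*$ the conjugate transpose (conjugate, for scalars), $\|\cdot\|_F$ the Frobenius norm, and $\measuredangle x$ the angle of a nonzero complex number $x$; angle differences are in degrees and understood modulo $360^\circ$. The ratio defining $\zeta$ presupposes $\mathrm{Tr}(\mathbf X^{\mathrm{opt}})>0$. The existence, for every noise vector, of a scalar $\beta>0$ with the stated bound on $\zeta$ is a separate theorem of the paper; $\zeta$ in this statement refers to that $\beta$. Network. $\mathcal G=(\mathcal N,\mathcal L)$ is the (connected) graph of a power network with bus set $\mathcal N=\{1,\dots,N\}$ and line set $\mathcal L$. $\mathcal G'=(\mathcal N,\mathcal L')$ is a subgraph of $\mathcal G$ containing a spanning tree of $\mathcal G$ (with at most one line between any two buses). Each line $l\in\mathcal L'$ is written $l=(s,t)$, where $s$ is its "from" end and $t$ its "to" end, and has branch admittance $y_{st}\in\mathbb C$. For $l=(s,t)\in\mathcal L'$, the matrix $\mathbf Y_{l,p_f}\in\mathbb H^N$ has only the following possibly nonzero entries: $\mathbf Y_{l,p_f}(s,t)=\mathbf Y_{l,p_f}(t,s)^*=-y_{st}/2$ and $\mathbf Y_{l,p_f}(s,s)=\mathrm{Re}(y_{st})$. Measurements. $\mathcal M=\{1,\dots,M\}$ with $M=N+|\mathcal L'|$;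 the lines of $\mathcal L'$ are numbered $1,\dots,|\mathcal L'|$. $\mathbf M_k=\mathbf e_k\mathbf e_k^\top$ for $k=1,\dots,N$ and $\mathbf M_{N+l}=\mathbf Y_{l,p_f}$ for $l\in\mathcal L'$. $\mathbf v$ is the true state. $\sigma_1,\dots,\sigma_M>0$ are constants and $f_{\mathrm{WLAV}}(\boldsymbol\nu)=\sum_{j=1}^M|\nu_j|/\sigma_j$ (the same $\sigma_j$ as in the noise covariance). Dual certificates. $\mathbf H(\boldsymbol\mu):=\mathbf M_0+\sum_{j=1}^M\mu_j\mathbf M_j$. A vector $\boldsymbol\mu\in\mathbb R^M$ is a dual SDP certificate for $\mathbf v$ if $\mathbf H(\boldsymbol\mu)\succeq\mathbf 0$, $\mathbf H(\boldsymbol\mu)\mathbf v=\mathbf 0$ and $\mathrm{rank}(\mathbf H(\boldsymbol\mu))=N-1$; $\mathcal D(\mathbf v)$ is the set of all of them. The sparsity graph of $\mathbf W\in\mathbb H^N$ is the simple undirected graph on $\{1,\dots,N\}$ in which distinct $i,j$ are adjacent iff $W_{i,j}\neq0$. Assumption 1. The edge set of the sparsity graph of $\mathbf M_0$ coincides with $\mathcal L'$, and, with $M_{0;st}$ denoting the $(s,t)$ entry of $\mathbf M_0$, for all $(s,t)\in\mathcal L'$: - $-180^\circ<\measuredangle M_{0;st}-\measuredangle y_{st}<0$; - $0<(\measuredangle v_s-\measuredangle v_t)-\measuredangle y_{st}<180^\circ$; - $(\measuredangle v_s-\measuredangle v_t)-\measuredangle M_{0;st}\neq 0$ or $180^\circ$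 (i.e. it equals neither value). Equivalently: $\mathrm{Im}(M_{0;st}y_{st}^* )<0$, $\mathrm{Im}(v_sv_t^*y_{st}^* )>0$, $\mathrm{Im}(v_sv_t^*M_{0;st}^* )\ne0$. *)

theory Defs
  imports
    "HOL-Probability.Probability"
    "Jordan_Normal_Form.Schur_Decomposition"
    "Jordan_Normal_Form.DL_Rank"
    "Graph_Theory.Digraph_Component"
begin

section \<open>Matrices\<close>

text \<open>
  Indices are 0-based: bus \<open>k\<close>, line \<open>l\<close> and measurement \<open>j\<close> of the mathematical text are
  \<open>k - 1\<close>, \<open>l - 1\<close> and \<open>j - 1\<close> here. For \<open>A\<close> and \<open>x\<close> of matching size, \<open>x\<^sup>* A x\<close> is
  \<open>(A *\<^sub>v x) \<bullet>c x\<close>, since \<open>\<bullet>c\<close> conjugates its second argument.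
\<close>

definition hermitian_mats :: "nat \<Rightarrow> complex mat set" where
  "hermitian_mats N = {A \<in> carrier_mat N N. mat_adjoint A = A}"

definition psd :: "nat \<Rightarrow> complex mat \<Rightarrow> bool" where
  "psd N A \<longleftrightarrow> A \<in> hermitian_mats N \<and> (\<forall>x \<in> carrier_vec N. 0 \<le> Re ((A *\<^sub>v x) \<bullet>c x))"

definition mat_trace :: "complex mat \<Rightarrow> complex" where
  "mat_trace A = (\<Sum>i<dim_row A. A $$ (i, i))"

definition frobenius_norm :: "complex mat \<Rightarrow> real" where
  "frobenius_norm A = sqrt (\<Sum>i<dim_row A. \<Sum>j<dim_col A. (cmod (A $$ (i, j)))\<^sup>2)"

text \<open>\<open>outer_prod u w\<close> is \<open>u w\<^sup>*\<close>.\<close>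

definition outer_prod :: "complex vec \<Rightarrow> complex vec \<Rightarrow> complex mat" where
  "outer_prod u w = mat (dim_vec u) (dim_vec w) (\<lambda>(i, j). u $ i * cnj (w $ j))"

text \<open>Meant for Hermitian matrices; eigenvalues are counted with multiplicity.\<close>

definition second_smallest_eigenvalue :: "complex mat \<Rightarrow> real" where
  "second_smallest_eigenvalue A =
     sorted_list_of_multiset (image_mset Re (proots (char_poly A))) ! 1"


section \<open>Network\<close>

text \<open>
  A network is an undirected (multi)graph whose lines carry a ``from'' end (\<open>tail\<close>) and a ``to'' end
  (\<open>head\<close>). The library notion \<open>connected\<close> disregards directions, but \<open>forest\<close> only excludes
  directed cycles. A cycle of the underlying undirected graph is a directed cycle for some choice of
  the directions.
\<close>

abbreviation line_ends :: "('a, 'l) pre_digraph \<Rightarrow> 'l \<Rightarrow> 'a set" where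
  "line_ends G l \<equiv> {tail G l, head G l}"

definition undirected_tree :: "('a, 'l) pre_digraph \<Rightarrow> bool" where
  "undirected_tree T \<longleftrightarrow> Digraph_Component.connected T \<and>
     (\<forall>T'. verts T' = verts T \<and> arcs T' = arcs T \<and> (\<forall>l \<in> arcs T. line_ends T' l = line_ends T l)
        \<longrightarrow> forest T')"

definition contains_spanning_tree_of :: "('a, 'l) pre_digraph \<Rightarrow> ('a, 'l) pre_digraph \<Rightarrow> bool" where
  "contains_spanning_tree_of G' G \<longleftrightarrow> (\<exists>T. subgraph T G' \<and> spanning T G \<and> undirected_tree T)"

definition line_flow_mat :: "nat \<Rightarrow> nat \<Rightarrow> nat \<Rightarrow> complex \<Rightarrow> complex mat" where
  "line_flow_mat N s t y = mat N N (\<lambda>(i, j).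
     if i = s \<and> j = t then - y / 2
     else if i = t \<and> j = s then cnj (- y / 2)
     else if i = s \<and> j = s then complex_of_real (Re y)
     else 0)"

text \<open>\<open>line\<close> is the numbering of the lines of \<open>G'\<close>; measurement \<open>N + l\<close> belongs to line number \<open>l\<close>.\<close>

definition measurement_mat ::
    "nat \<Rightarrow> (nat, 'l) pre_digraph \<Rightarrow> (nat \<Rightarrow> 'l) \<Rightarrow> ('l \<Rightarrow> complex) \<Rightarrow> nat \<Rightarrow> complex mat" where
  "measurement_mat N G' line y k =
     (if k < N then outer_prod (unit_vec N k) (unit_vec N k)
      else let l = line (k - N) in line_flow_mat N (tail G' l) (head G' l) (y l))"

definition sparsity_edges :: "nat \<Rightarrow> complex mat \<Rightarrow> nat set set" where
  "sparsity_edges N W = {{i, j} | i j. i < N \<and> j < N \<and> i \<noteq> j \<and> W $$ (i, j) \<noteq> 0}"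


section \<open>Angle conditions\<close>

definition angle_deg :: "complex \<Rightarrow> real" where
  "angle_deg x = Arg x * 180 / pi"

text \<open>\<open>d\<close> lies strictly between \<open>a\<close> and \<open>b\<close> modulo 360 degrees.\<close>

definition between_mod360 :: "real \<Rightarrow> real \<Rightarrow> real \<Rightarrow> bool" where
  "between_mod360 a d b \<longleftrightarrow> (\<exists>k::int. a < d + 360 * of_int k \<and> d + 360 * of_int k < b)"

definition eq_mod360 :: "real \<Rightarrow> real \<Rightarrow> bool" where
  "eq_mod360 c d \<longleftrightarrow> (\<exists>k::int. c = d + 360 * of_int k)"

text \<open>The angles involved are those of nonzero numbers, hence the nonvanishing requirements.\<close>

definition angle_assumption ::
    "nat \<Rightarrow> (nat, 'l) pre_digraph \<Rightarrow> ('l \<Rightarrow> complex) \<Rightarrow> complex mat \<Rightarrow> complex vec \<Rightarrow> bool" where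
  "angle_assumption N G' y M0 v \<longleftrightarrow>
     sparsity_edges N M0 = line_ends G' ` arcs G' \<and>
     (\<forall>l \<in> arcs G'. let s = tail G' l; t = head G' l in
        v $ s \<noteq> 0 \<and> v $ t \<noteq> 0 \<and> y l \<noteq> 0 \<and> M0 $$ (s, t) \<noteq> 0 \<and>
        between_mod360 (-180) (angle_deg (M0 $$ (s, t)) - angle_deg (y l)) 0 \<and>
        between_mod360 0 ((angle_deg (v $ s) - angle_deg (v $ t)) - angle_deg (y l)) 180 \<and>
        \<not> eq_mod360 ((angle_deg (v $ s) - angle_deg (v $ t)) - angle_deg (M0 $$ (s, t))) 0 \<and>
        \<not> eq_mod360 ((angle_deg (v $ s) - angle_deg (v $ t)) - angle_deg (M0 $$ (s, t))) 180)"


section \<open>Dual certificates and the penalized semidefinite program\<close>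

text \<open>
  Below, \<open>M\<close> is the number of measurements and \<open>A j\<close> for \<open>j < M\<close> are the measurement matrices.
  A vector of length \<open>M\<close> is a function on \<open>nat\<close> of which only the values below \<open>M\<close> matter.
\<close>

definition dual_mat :: "nat \<Rightarrow> nat \<Rightarrow> complex mat \<Rightarrow> (nat \<Rightarrow> complex mat) \<Rightarrow> (nat \<Rightarrow> real) \<Rightarrow> complex mat"
  where
  "dual_mat N M M0 A \<mu> =
     mat N N (\<lambda>(i, k). M0 $$ (i, k) + (\<Sum>j<M. complex_of_real (\<mu> j) * A j $$ (i, k)))"

definition dual_sdp_certs ::
    "nat \<Rightarrow> nat \<Rightarrow> complex mat \<Rightarrow> (nat \<Rightarrow> complex mat) \<Rightarrow> complex vec \<Rightarrow> (nat \<Rightarrow> real) set" where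
  "dual_sdp_certs N M M0 A v =
     {\<mu>. psd N (dual_mat N M M0 A \<mu>) \<and>
         dual_mat N M M0 A \<mu> *\<^sub>v v = 0\<^sub>v N \<and>
         vec_space.rank N (dual_mat N M M0 A \<mu>) = N - 1}"

definition wlav :: "nat \<Rightarrow> (nat \<Rightarrow> real) \<Rightarrow> (nat \<Rightarrow> real) \<Rightarrow> real" where
  "wlav M \<sigma> \<nu> = (\<Sum>j<M. \<bar>\<nu> j\<bar> / \<sigma> j)"

text \<open>The traces below are real, because the matrices involved are Hermitian.\<close>

definition sdp_feasible ::
    "nat \<Rightarrow> nat \<Rightarrow> (nat \<Rightarrow> complex mat) \<Rightarrow> (nat \<Rightarrow> complex) \<Rightarrow> complex mat \<Rightarrow> (nat \<Rightarrow> real) \<Rightarrow> bool" where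
  "sdp_feasible N M A z X \<nu> \<longleftrightarrow>
     X \<in> hermitian_mats N \<and>
     (\<forall>j<M. mat_trace (A j * X) + complex_of_real (\<nu> j) = z j) \<and>
     psd N X"

definition sdp_objective ::
    "nat \<Rightarrow> complex mat \<Rightarrow> (nat \<Rightarrow> real) \<Rightarrow> real \<Rightarrow> complex mat \<Rightarrow> (nat \<Rightarrow> real) \<Rightarrow> real" where
  "sdp_objective M M0 \<sigma> \<rho> X \<nu> = \<rho> * wlav M \<sigma> \<nu> + Re (mat_trace (M0 * X))"

definition sdp_optimal ::
    "nat \<Rightarrow> nat \<Rightarrow> complex mat \<Rightarrow> (nat \<Rightarrow> complex mat) \<Rightarrow> (nat \<Rightarrow> real) \<Rightarrow> real \<Rightarrow> (nat \<Rightarrow> complex) \<Rightarrow>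
     complex mat \<Rightarrow> (nat \<Rightarrow> real) \<Rightarrow> bool" where
  "sdp_optimal N M M0 A \<sigma> \<rho> z X \<nu> \<longleftrightarrow>
     sdp_feasible N M A z X \<nu> \<and>
     (\<forall>X' \<nu>'. sdp_feasible N M A z X' \<nu>' \<longrightarrow>
        sdp_objective M M0 \<sigma> \<rho> X \<nu> \<le> sdp_objective M M0 \<sigma> \<rho> X' \<nu>')"

text \<open>
  The ratio is meaningful only if the trace of \<open>X\<close> is positive. For a positive semidefinite \<open>X\<close> of
  trace zero its value is \<open>0\<close>, by the convention \<open>x / 0 = 0\<close>; so for \<open>t > 0\<close> the event that the
  error exceeds \<open>t\<close> consists only of outcomes where the error is meaningful.
\<close>

definition estimation_error :: "nat \<Rightarrow> complex vec \<Rightarrow> real \<Rightarrow> complex mat \<Rightarrow> real" where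
  "estimation_error N v \<beta> X =
     frobenius_norm (X - complex_of_real \<beta> \<cdot>\<^sub>m outer_prod v v) / sqrt (real N * Re (mat_trace X))"


section \<open>Gaussian vectors\<close>

text \<open>Normal distribution with mean \<open>m\<close> and standard deviation \<open>s\<close>; \<open>s = 0\<close> is the point mass at \<open>m\<close>.\<close>

definition normal_rv :: "'w measure \<Rightarrow> ('w \<Rightarrow> real) \<Rightarrow> real \<Rightarrow> real \<Rightarrow> bool" where
  "normal_rv P Y m s \<longleftrightarrow>
     Y \<in> borel_measurable P \<and> 0 \<le> s \<and>
     (if s = 0 then AE \<omega> in P. Y \<omega> = m
      else distributed P lborel Y (\<lambda>x. ennreal (normal_density m s x)))"

definition gaussian_vector :: "'w measure \<Rightarrow> 'i set \<Rightarrow> ('i \<Rightarrow> 'w \<Rightarrow> real) \<Rightarrow> bool" where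
  "gaussian_vector P J X \<longleftrightarrow>
     (\<forall>a. \<exists>m s. normal_rv P (\<lambda>\<omega>. \<Sum>j\<in>J. a j * X j \<omega>) m s)"

definition covariance :: "'w measure \<Rightarrow> ('w \<Rightarrow> real) \<Rightarrow> ('w \<Rightarrow> real) \<Rightarrow> real" where
  "covariance P X Y =
     (\<integral>\<omega>. (X \<omega> - (\<integral>\<omega>'. X \<omega>' \<partial>P)) * (Y \<omega> - (\<integral>\<omega>'. Y \<omega>' \<partial>P)) \<partial>P)"

end

theory Submission
  imports Defs
begin

text \<open>
  The error bound involves the noise only through the normalized \<open>\<ell>\<^sub>1\<close> norm \<open>wlav M \<sigma> \<eta>\<close>, so the
  claim is a large deviation estimate for that norm. Squaring \<open>t < \<zeta> \<le> 2 sqrt (\<rho> wlav M \<sigma> \<eta> / (N \<lambda>))\<close>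
  and writing \<open>N = M / \<kappa>\<close> gives \<open>a M < wlav M \<sigma> \<eta>\<close> with \<open>a = t\<^sup>2 \<lambda> / (4 \<kappa> \<rho>)\<close>. If the trace of
  the optimal matrix or \<open>\<lambda>\<close> is not positive, then \<open>\<zeta> \<le> 0\<close>, and \<open>\<zeta>\<close> does not exceed \<open>t\<close>.

  The tail of the norm is found by linearization: \<open>wlav M \<sigma> \<eta>\<close> is the largest of the \<open>2 ^ M\<close> signed sums
  of the \<open>\<eta> j / \<sigma> j\<close>. Each signed sum is a linear functional of a Gaussian vector, hence normal, and
  uncorrelatedness of the components makes its variance \<open>M\<close> whatever the signs
  (\<open>gaussian_vector_lincomb\<close>). It therefore exceeds \<open>a M\<close> with probability at most
  \<open>exp (- (a M)\<^sup>2 / (2 M)) = exp (- M a\<^sup>2 / 2)\<close> (\<open>normal_rv_tail\<close>). The union bound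
  (\<open>gaussian_vector_l1_tail\<close>) costs the factor \<open>2 ^ M\<close>, which is the \<open>ln 2\<close> in \<open>\<gamma>\<close>, and \<open>a\<^sup>2 / 2\<close> is the
  other term of \<open>\<gamma>\<close>.
\<close>

lemma (in prob_space) normal_rv_moments:
  assumes "normal_rv M Y m s"
  shows "integrable M Y" "integrable M (\<lambda>\<omega>. (Y \<omega>)\<^sup>2)"
    and "expectation Y = m" "variance Y = s\<^sup>2"
proof -
  have Y [measurable]: "Y \<in> borel_measurable M" and s: "0 \<le> s"
    using assms by (auto simp: normal_rv_def)
  have "integrable M Y \<and> integrable M (\<lambda>\<omega>. (Y \<omega>)\<^sup>2) \<and> expectation Y = m \<and> variance Y = s\<^sup>2"
  proof (cases "s = 0")
    case True
    then have ae: "AE \<omega> in M. Y \<omega> = m"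
      using assms by (simp add: normal_rv_def)
    have "integrable M Y \<longleftrightarrow> integrable M (\<lambda>_. m)"
      by (rule integrable_cong_AE) (use ae in auto)
    moreover have "integrable M (\<lambda>\<omega>. (Y \<omega>)\<^sup>2) \<longleftrightarrow> integrable M (\<lambda>_. m\<^sup>2)"
      by (rule integrable_cong_AE) (use ae in auto)
    moreover have e: "expectation Y = expectation (\<lambda>_. m)"
      by (rule integral_cong_AE) (use ae in auto)
    moreover have "variance Y = expectation (\<lambda>_. 0)"
      by (rule integral_cong_AE) (use ae e in \<open>auto simp: prob_space\<close>)
    ultimately show ?thesis
      using True by (simp add: prob_space)
  next
    case False
    with s have pos: "0 < s" by simp
    have D: "distributed M lborel Y (normal_density m s)"
      using assms False by (simp add: normal_rv_def)
    have int1: "integrable M Y"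
      using distributed_integrable[OF D, of "\<lambda>x. x"] integrable_normal_moment_nz_1[OF pos, of m]
      by simp
    have "integrable M (\<lambda>\<omega>. (Y \<omega> - m)\<^sup>2)"
      using distributed_integrable[OF D, of "\<lambda>x. (x - m)\<^sup>2"] integrable_normal_moment[OF pos, of m 2]
      by simp
    then have "integrable M (\<lambda>\<omega>. (Y \<omega> - m)\<^sup>2 + 2 * m * Y \<omega> - m\<^sup>2)"
      using int1 by simp
    then have "integrable M (\<lambda>\<omega>. (Y \<omega>)\<^sup>2)"
      by (simp add: power2_eq_square algebra_simps)
    with int1 show ?thesis
      using normal_distributed_expectation[OF pos D] normal_distributed_variance[OF pos D] by simp
  qed
  then show "integrable M Y" "integrable M (\<lambda>\<omega>. (Y \<omega>)\<^sup>2)"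
    and "expectation Y = m" "variance Y = s\<^sup>2"
    by auto
qed

text \<open>
  For \<open>0 \<le> x \<le> u\<close> one has \<open>x\<^sup>2 + (u - x)\<^sup>2 \<le> u\<^sup>2\<close>, so beyond \<open>x\<close> the density is at most
  \<open>exp (- x\<^sup>2 / (2 s\<^sup>2))\<close> times a translated normal density, whose total mass is \<open>1\<close>.
\<close>

lemma (in prob_space) normal_rv_tail:
  assumes Y: "normal_rv M Y 0 s" and s: "0 < s" and x: "0 \<le> x"
  shows "prob {\<omega> \<in> space M. x < Y \<omega>} \<le> exp (- x\<^sup>2 / (2 * s\<^sup>2))"
proof -
  let ?c = "exp (- x\<^sup>2 / (2 * s\<^sup>2))"
  have D: "distributed M lborel Y (normal_density 0 s)"
    using Y s by (simp add: normal_rv_def)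
  have bound: "normal_density 0 s u * indicator {x<..} u \<le> ?c * normal_density x s u" for u
  proof (cases "x < u")
    case True
    have "0 \<le> x * (u - x)"
      using True x by simp
    then have "- (u\<^sup>2) \<le> - x\<^sup>2 - (u - x)\<^sup>2"
      by (simp add: power2_eq_square algebra_simps)
    then have "- (u\<^sup>2) / (2 * s\<^sup>2) \<le> - x\<^sup>2 / (2 * s\<^sup>2) + - ((u - x)\<^sup>2) / (2 * s\<^sup>2)"
      using divide_right_mono[of _ _ "2 * s\<^sup>2"] by (fastforce simp: diff_divide_distrib)
    then have "exp (- (u\<^sup>2) / (2 * s\<^sup>2)) \<le> ?c * exp (- ((u - x)\<^sup>2) / (2 * s\<^sup>2))"
      by (simp flip: exp_add)
    then have "1 / sqrt (2 * pi * s\<^sup>2) * exp (- (u\<^sup>2) / (2 * s\<^sup>2))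
        \<le> 1 / sqrt (2 * pi * s\<^sup>2) * (?c * exp (- ((u - x)\<^sup>2) / (2 * s\<^sup>2)))"
      by (rule mult_left_mono) simp
    then show ?thesis
      using True by (simp add: normal_density_def mult_ac)
  qed simp
  have "emeasure M {\<omega> \<in> space M. x < Y \<omega>} = emeasure M (Y -` {x<..} \<inter> space M)"
    by (rule arg_cong[where f = "emeasure M"]) auto
  also have "\<dots> = (\<integral>\<^sup>+u. ennreal (normal_density 0 s u) * indicator {x<..} u \<partial>lborel)"
    by (rule distributed_emeasure[OF D]) simp
  also have "\<dots> \<le> (\<integral>\<^sup>+u. ennreal ?c * ennreal (normal_density x s u) \<partial>lborel)"
  proof (rule nn_integral_mono)
    fix u :: real
    show "ennreal (normal_density 0 s u) * indicator {x<..} u \<le> ennreal ?c * ennreal (normal_density x s u)"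
      using ennreal_leI[OF bound[of u]] by (simp add: ennreal_mult ennreal_indicator)
  qed
  also have "\<dots> = ennreal ?c * (\<integral>\<^sup>+u. ennreal (normal_density x s u) \<partial>lborel)"
    by (rule nn_integral_cmult) simp
  also have "(\<integral>\<^sup>+u. ennreal (normal_density x s u) \<partial>lborel) = 1"
    using s by (subst nn_integral_eq_integral) auto
  finally show ?thesis
    by (simp add: emeasure_eq_measure)
qed

lemma (in prob_space) gaussian_vector_component:
  assumes "gaussian_vector M J X" "finite J" "j \<in> J"
  shows "\<exists>m s. normal_rv M (X j) m s"
proof -
  obtain m s where "normal_rv M (\<lambda>\<omega>. \<Sum>i\<in>J. (if i = j then 1 else 0) * X i \<omega>) m s"
    using assms(1) unfolding gaussian_vector_def by fast
  moreover have "(\<Sum>i\<in>J. (if i = j then 1 else 0) * X i \<omega>) = X j \<omega>" for \<omega>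
    using assms(2,3) by (simp add: if_distrib[of "\<lambda>c. c * _"] cong: if_cong)
  ultimately show ?thesis
    by auto
qed

text \<open>
  The parameters of the normal law of a linear combination are its mean and standard deviation; the
  mixed terms of the variance vanish because the components are uncorrelated.
\<close>

lemma (in prob_space) gaussian_vector_lincomb:
  assumes G: "gaussian_vector M J X" and fin: "finite J"
    and mean: "\<And>j. j \<in> J \<Longrightarrow> expectation (X j) = 0"
    and cov: "\<And>i j. i \<in> J \<Longrightarrow> j \<in> J \<Longrightarrow> covariance M (X i) (X j) = (if i = j then (\<sigma> i)\<^sup>2 else 0)"
  shows "normal_rv M (\<lambda>\<omega>. \<Sum>j\<in>J. a j * X j \<omega>) 0 (sqrt (\<Sum>j\<in>J. (a j * \<sigma> j)\<^sup>2))"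
proof -
  let ?Y = "\<lambda>\<omega>. \<Sum>j\<in>J. a j * X j \<omega>"
  obtain m s where Y: "normal_rv M ?Y m s"
    using G unfolding gaussian_vector_def by blast
  have comp: "integrable M (X j)" "integrable M (\<lambda>\<omega>. (X j \<omega>)\<^sup>2)" if j: "j \<in> J" for j
  proof -
    obtain m' s' where "normal_rv M (X j) m' s'"
      using gaussian_vector_component[OF G fin j] by blast
    then show "integrable M (X j)" "integrable M (\<lambda>\<omega>. (X j \<omega>)\<^sup>2)"
      by (rule normal_rv_moments)+
  qed
  have prod: "integrable M (\<lambda>\<omega>. X i \<omega> * X j \<omega>)" if ij: "i \<in> J" "j \<in> J" for i j
  proof (rule Bochner_Integration.integrable_bound)
    show "integrable M (\<lambda>\<omega>. (X i \<omega>)\<^sup>2 + (X j \<omega>)\<^sup>2)"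
      using comp ij by simp
    show "(\<lambda>\<omega>. X i \<omega> * X j \<omega>) \<in> borel_measurable M"
      using comp(1) ij by (intro borel_measurable_times borel_measurable_integrable)
    have "\<bar>p * q\<bar> \<le> p\<^sup>2 + q\<^sup>2" for p q :: real
    proof -
      have "2 * \<bar>p\<bar> * \<bar>q\<bar> \<le> p\<^sup>2 + q\<^sup>2"
        using sum_squares_bound[of "\<bar>p\<bar>" "\<bar>q\<bar>"] by simp
      moreover have "0 \<le> \<bar>p\<bar> * \<bar>q\<bar>"
        by simp
      ultimately show ?thesis
        unfolding abs_mult by linarith
    qed
    then show "AE \<omega> in M. norm (X i \<omega> * X j \<omega>) \<le> norm ((X i \<omega>)\<^sup>2 + (X j \<omega>)\<^sup>2)"
      by simp
  qed
  have "m = expectation ?Y"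
    using normal_rv_moments(3)[OF Y] by simp
  also have "\<dots> = (\<Sum>j\<in>J. a j * expectation (X j))"
    using comp(1) by (subst Bochner_Integration.integral_sum) auto
  finally have m: "m = 0"
    using mean by simp
  have "s\<^sup>2 = expectation (\<lambda>\<omega>. (?Y \<omega>)\<^sup>2)"
    using normal_rv_moments(3,4)[OF Y] m by simp
  also have "\<dots> = expectation (\<lambda>\<omega>. \<Sum>i\<in>J. \<Sum>j\<in>J. a i * a j * (X i \<omega> * X j \<omega>))"
    by (simp add: power2_eq_square sum_product mult_ac)
  also have "\<dots> = (\<Sum>i\<in>J. \<Sum>j\<in>J. a i * a j * expectation (\<lambda>\<omega>. X i \<omega> * X j \<omega>))"
    using prod by (simp add: Bochner_Integration.integral_sum)
  also have "\<dots> = (\<Sum>i\<in>J. \<Sum>j\<in>J. a i * a j * (if i = j then (\<sigma> i)\<^sup>2 else 0))"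
    using cov mean by (intro sum.cong refl) (simp add: covariance_def)
  also have "\<dots> = (\<Sum>j\<in>J. (a j * \<sigma> j)\<^sup>2)"
    using fin by (simp add: if_distrib[of "\<lambda>c. _ * c"] power2_eq_square mult_ac cong: if_cong)
  finally have "s\<^sup>2 = (\<Sum>j\<in>J. (a j * \<sigma> j)\<^sup>2)" .
  moreover have "0 \<le> s"
    using Y by (simp add: normal_rv_def)
  ultimately have "s = sqrt (\<Sum>j\<in>J. (a j * \<sigma> j)\<^sup>2)"
    by (metis real_sqrt_unique)
  with Y m show ?thesis
    by simp
qed

text \<open>
  The absolute values are resolved by a choice of signs: at every outcome one of the
  \<open>2 ^ card J\<close> signed sums equals the normalized \<open>\<ell>\<^sub>1\<close> norm, and all signed sums have the same
  variance \<open>card J\<close>.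
\<close>

lemma (in prob_space) gaussian_vector_l1_tail:
  assumes G: "gaussian_vector M J X" and fin: "finite J" and ne: "J \<noteq> {}"
    and mean: "\<And>j. j \<in> J \<Longrightarrow> expectation (X j) = 0"
    and cov: "\<And>i j. i \<in> J \<Longrightarrow> j \<in> J \<Longrightarrow> covariance M (X i) (X j) = (if i = j then (\<sigma> i)\<^sup>2 else 0)"
    and \<sigma>: "\<And>j. j \<in> J \<Longrightarrow> 0 < \<sigma> j" and a: "0 \<le> a"
  shows "{\<omega> \<in> space M. a * real (card J) < (\<Sum>j\<in>J. \<bar>X j \<omega>\<bar> / \<sigma> j)} \<in> events" (is "?E \<in> events")
    and "prob {\<omega> \<in> space M. a * real (card J) < (\<Sum>j\<in>J. \<bar>X j \<omega>\<bar> / \<sigma> j)}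
           \<le> 2 ^ card J * exp (- (real (card J) * a\<^sup>2 / 2))"
proof -
  let ?n = "real (card J)"
  let ?b = "\<lambda>S j. (if j \<in> S then 1 else - 1) / \<sigma> j"
  let ?B = "\<lambda>S. {\<omega> \<in> space M. a * ?n < (\<Sum>j\<in>J. ?b S j * X j \<omega>)}"
  have n: "0 < ?n"
    using fin ne by (simp add: card_gt_0_iff)
  have [measurable]: "X j \<in> borel_measurable M" if "j \<in> J" for j
    using gaussian_vector_component[OF G fin that] by (auto simp: normal_rv_def)
  show "?E \<in> events"
    by measurable
  have B_events: "?B S \<in> events" for S
    by measurable
  have B_prob: "prob (?B S) \<le> exp (- (?n * a\<^sup>2 / 2))" for S
  proof -
    have "(\<Sum>j\<in>J. (?b S j * \<sigma> j)\<^sup>2) = (\<Sum>j\<in>J. 1)"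
      by (rule sum.cong) (use \<sigma> in \<open>auto simp: less_le\<close>)
    then have "normal_rv M (\<lambda>\<omega>. \<Sum>j\<in>J. ?b S j * X j \<omega>) 0 (sqrt ?n)"
      using gaussian_vector_lincomb[OF G fin mean cov, of "?b S"] by simp
    then have "prob (?B S) \<le> exp (- (a * ?n)\<^sup>2 / (2 * (sqrt ?n)\<^sup>2))"
      by (rule normal_rv_tail) (use n a in auto)
    also have "- (a * ?n)\<^sup>2 / (2 * (sqrt ?n)\<^sup>2) = - (?n * a\<^sup>2 / 2)"
      using n by (simp add: power2_eq_square field_simps)
    finally show ?thesis .
  qed
  have "?E \<subseteq> (\<Union>S\<in>Pow J. ?B S)"
  proof
    fix \<omega> assume \<omega>: "\<omega> \<in> ?E"
    let ?S = "{j \<in> J. 0 \<le> X j \<omega>}"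
    have "(\<Sum>j\<in>J. ?b ?S j * X j \<omega>) = (\<Sum>j\<in>J. \<bar>X j \<omega>\<bar> / \<sigma> j)"
      by (rule sum.cong) auto
    with \<omega> have "\<omega> \<in> ?B ?S"
      by simp
    then show "\<omega> \<in> (\<Union>S\<in>Pow J. ?B S)"
      by (rule UN_I[rotated]) auto
  qed
  then have "prob ?E \<le> prob (\<Union>S\<in>Pow J. ?B S)"
    using fin B_events by (intro finite_measure_mono sets.finite_UN) auto
  also have "\<dots> \<le> (\<Sum>S\<in>Pow J. prob (?B S))"
    using fin B_events by (intro finite_measure_subadditive_finite) auto
  also have "\<dots> \<le> (\<Sum>S\<in>Pow J. exp (- (?n * a\<^sup>2 / 2)))"
    by (intro sum_mono B_prob)
  also have "\<dots> = 2 ^ card J * exp (- (?n * a\<^sup>2 / 2))"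
    using fin by (simp add: card_Pow)
  finally show "prob ?E \<le> 2 ^ card J * exp (- (?n * a\<^sup>2 / 2))" .
qed

theorem corollary3:
  fixes N M :: nat
    and G G' :: "(nat, 'l) pre_digraph"
    and line :: "nat \<Rightarrow> 'l"
    and y :: "'l \<Rightarrow> complex"
    and A :: "nat \<Rightarrow> complex mat"
    and M0 :: "complex mat"
    and v :: "complex vec"
    and \<sigma> \<mu> :: "nat \<Rightarrow> real"
    and \<rho> lam \<kappa> \<gamma> t :: real
    and P :: "'w measure"
    and \<eta> :: "nat \<Rightarrow> 'w \<Rightarrow> real"
    and z :: "'w \<Rightarrow> nat \<Rightarrow> complex"
    and Xopt :: "'w \<Rightarrow> complex mat"
    and \<nu>opt :: "'w \<Rightarrow> nat \<Rightarrow> real"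
    and \<beta> \<zeta> :: "'w \<Rightarrow> real"
  assumes "2 \<le> N"
    and "fin_digraph G" and "verts G = {..<N}" and "Digraph_Component.connected G"
    and "subgraph G' G" and "contains_spanning_tree_of G' G"
    and "inj_on (line_ends G') (arcs G')"
    and "bij_betw line {..<card (arcs G')} (arcs G')"
    and "M = N + card (arcs G')"
    and "A = measurement_mat N G' line y"
    and "v \<in> carrier_vec N" and "M0 \<in> hermitian_mats N"
    and "angle_assumption N G' y M0 v"
    and "\<mu> \<in> dual_sdp_certs N M M0 A v"
    and "\<forall>j<M. 0 < \<sigma> j"
    and "0 < \<rho>" and "Max ((\<lambda>j. \<bar>\<sigma> j * \<mu> j\<bar>) ` {..<M}) \<le> \<rho>"
    and "lam = second_smallest_eigenvalue (dual_mat N M M0 A \<mu>)"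
    and "prob_space P"
    and "gaussian_vector P {..<M} \<eta>"
    and "\<forall>j<M. prob_space.expectation P (\<eta> j) = 0"
    and "\<forall>i<M. \<forall>j<M. covariance P (\<eta> i) (\<eta> j) = (if i = j then (\<sigma> i)\<^sup>2 else 0)"
    and "\<forall>\<omega> \<in> space P. \<forall>j<M. z \<omega> j = (A j *\<^sub>v v) \<bullet>c v + complex_of_real (\<eta> j \<omega>)"
    and "\<forall>\<omega> \<in> space P. sdp_optimal N M M0 A \<sigma> \<rho> (z \<omega>) (Xopt \<omega>) (\<nu>opt \<omega>)"
    and "\<forall>\<omega> \<in> space P. \<zeta> \<omega> = estimation_error N v (\<beta> \<omega>) (Xopt \<omega>)"
    and "\<forall>\<omega> \<in> space P. 0 < Re (mat_trace (Xopt \<omega>)) \<longrightarrow>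
           0 < \<beta> \<omega> \<and> \<zeta> \<omega> \<le> 2 * sqrt (\<rho> * wlav M \<sigma> (\<lambda>j. \<eta> j \<omega>) / (real N * lam))"
    and "0 < t"
    and "\<kappa> = real M / real N"
    and "\<gamma> = t ^ 4 * lam\<^sup>2 / (32 * \<kappa>\<^sup>2 * \<rho>\<^sup>2) - ln 2"
  shows "measure P {\<omega> \<in> space P. t < \<zeta> \<omega>} \<le> exp (- \<gamma> * real M) \<and>
         outer_measure_of P {\<omega> \<in> space P. t < \<zeta> \<omega>} \<le> ennreal (exp (- \<gamma> * real M))"
proof -
  interpret prob_space P
    by fact
  have N: "0 < real N" and M: "0 < M"
    using \<open>2 \<le> N\<close> \<open>M = N + card (arcs G')\<close> by auto
  have \<kappa>: "0 < \<kappa>"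
    using N M \<open>\<kappa> = real M / real N\<close> by simp
  have M_eq: "real M = \<kappa> * real N"
    using N \<open>\<kappa> = real M / real N\<close> by simp
  let ?E = "{\<omega> \<in> space P. t < \<zeta> \<omega>}"
  have large: "0 < lam \<and> t\<^sup>2 * lam / (4 * \<kappa> * \<rho>) * real M < wlav M \<sigma> (\<lambda>j. \<eta> j \<omega>)"
    if \<omega>: "\<omega> \<in> ?E" for \<omega>
  proof -
    let ?f = "wlav M \<sigma> (\<lambda>j. \<eta> j \<omega>)"
    have "0 < \<zeta> \<omega>" and "\<omega> \<in> space P"
      using \<omega> \<open>0 < t\<close> by auto
    \<comment> \<open>\<open>sqrt\<close> is odd on the reals and \<open>x / 0 = 0\<close>, so an error with a nonpositive trace is nonpositive;
        below, the same convention makes the bound on the error nonpositive if \<open>lam\<close> is.\<close>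
    have "0 < Re (mat_trace (Xopt \<omega>))"
    proof (rule ccontr)
      assume "\<not> 0 < Re (mat_trace (Xopt \<omega>))"
      then have "sqrt (real N * Re (mat_trace (Xopt \<omega>))) \<le> 0"
        using N by (simp add: mult_nonneg_nonpos)
      moreover have "0 \<le> frobenius_norm (Xopt \<omega> - complex_of_real (\<beta> \<omega>) \<cdot>\<^sub>m outer_prod v v)"
        unfolding frobenius_norm_def by (intro real_sqrt_ge_zero sum_nonneg) simp
      ultimately have "estimation_error N v (\<beta> \<omega>) (Xopt \<omega>) \<le> 0"
        unfolding estimation_error_def by (rule divide_nonneg_nonpos[rotated])
      with \<open>0 < \<zeta> \<omega>\<close> \<open>\<omega> \<in> space P\<close> \<open>\<forall>\<omega> \<in> space P. \<zeta> \<omega> = estimation_error N v (\<beta> \<omega>) (Xopt \<omega>)\<close>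
      show False
        by simp
    qed
    then have le: "\<zeta> \<omega> \<le> 2 * sqrt (\<rho> * ?f / (real N * lam))"
      using assms(26) \<open>\<omega> \<in> space P\<close> by blast
    have f: "0 \<le> ?f"
      unfolding wlav_def using \<open>\<forall>j<M. 0 < \<sigma> j\<close> by (intro sum_nonneg) (simp add: less_imp_le)
    have t: "t / 2 < sqrt (\<rho> * ?f / (real N * lam))"
      using le \<omega> by simp
    have lam: "0 < lam"
    proof (rule ccontr)
      assume "\<not> 0 < lam"
      then have "real N * lam \<le> 0"
        using N by (simp add: mult_nonneg_nonpos)
      then have "\<rho> * ?f / (real N * lam) \<le> 0"
        using f \<open>0 < \<rho>\<close> by (intro divide_nonneg_nonpos) auto
      then have "sqrt (\<rho> * ?f / (real N * lam)) \<le> 0"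
        by simp
      with t \<open>0 < t\<close> show False
        by simp
    qed
    have "(t / 2)\<^sup>2 < (sqrt (\<rho> * ?f / (real N * lam)))\<^sup>2"
      using t \<open>0 < t\<close> by (intro power_strict_mono) auto
    also have "\<dots> = \<rho> * ?f / (real N * lam)"
      using f lam N \<open>0 < \<rho>\<close> by simp
    finally have "(t / 2)\<^sup>2 * (real N * lam) < \<rho> * ?f"
      using lam N by (simp add: pos_less_divide_eq)
    then have "(t / 2)\<^sup>2 * (real N * lam) / \<rho> < ?f"
      using \<open>0 < \<rho>\<close> by (simp add: pos_divide_less_eq mult.commute)
    moreover have "(t / 2)\<^sup>2 * (real N * lam) / \<rho> = t\<^sup>2 * lam / (4 * \<kappa> * \<rho>) * real M"
      using \<kappa> \<open>0 < \<rho>\<close> unfolding M_eq by (simp add: power2_eq_square field_simps)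
    ultimately show ?thesis
      using lam by simp
  qed
  \<comment> \<open>The event need not be measurable, since \<open>Xopt\<close> and \<open>\<beta>\<close> are arbitrary functions of the outcome;
      a measurable superset of small probability controls its outer measure.\<close>
  have "\<exists>B \<in> events. ?E \<subseteq> B \<and> prob B \<le> exp (- \<gamma> * real M)"
  proof (cases "0 < lam")
    case False
    then have "?E = {}"
      using large by blast
    then show ?thesis
      by (intro bexI[of _ "{}"]) auto
  next
    case True
    let ?a = "t\<^sup>2 * lam / (4 * \<kappa> * \<rho>)"
    let ?B = "{\<omega> \<in> space P. ?a * real M < wlav M \<sigma> (\<lambda>j. \<eta> j \<omega>)}"
    have a: "0 \<le> ?a"
      using True \<kappa> \<open>0 < \<rho>\<close> by simp
    have ne: "{..<M} \<noteq> {}"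
      using M by (simp add: lessThan_empty_iff)
    have mean: "expectation (\<eta> j) = 0" if "j \<in> {..<M}" for j
      using \<open>\<forall>j<M. expectation (\<eta> j) = 0\<close> that by simp
    have cov: "covariance P (\<eta> i) (\<eta> j) = (if i = j then (\<sigma> i)\<^sup>2 else 0)"
      if "i \<in> {..<M}" "j \<in> {..<M}" for i j
      using assms(22) that by simp
    have \<sigma>: "0 < \<sigma> j" if "j \<in> {..<M}" for j
      using \<open>\<forall>j<M. 0 < \<sigma> j\<close> that by simp
    note tail = gaussian_vector_l1_tail[OF \<open>gaussian_vector P {..<M} \<eta>\<close> finite_lessThan ne mean cov \<sigma> a,
        unfolded card_lessThan, folded wlav_def]
    have B: "prob ?B \<le> 2 ^ M * exp (- (real M * ?a\<^sup>2 / 2))"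
      by (rule tail(2))
    have a_sq: "?a\<^sup>2 = 2 * (\<gamma> + ln 2)"
      using \<open>\<gamma> = _\<close> by (simp add: power_divide power_mult_distrib mult_ac flip: power_mult)
    have "2 ^ M = exp (real M * ln 2)"
      by (simp add: exp_of_nat_mult)
    then have "2 ^ M * exp (- (real M * ?a\<^sup>2 / 2)) = exp (real M * ln 2 - real M * ?a\<^sup>2 / 2)"
      by (simp add: exp_diff exp_minus field_simps)
    also have "real M * ln 2 - real M * ?a\<^sup>2 / 2 = - \<gamma> * real M"
      unfolding a_sq by (simp add: algebra_simps)
    finally have "prob ?B \<le> exp (- \<gamma> * real M)"
      using B by simp
    moreover have "?E \<subseteq> ?B"
      using large by blast
    ultimately show ?thesis
      using tail(1) by blast
  qed
  then obtain B where B: "B \<in> events" "?E \<subseteq> B" "prob B \<le> exp (- \<gamma> * real M)"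
    by blast
  have "prob ?E \<le> prob B"
    using B by (intro finite_measure_mono)
  moreover have "outer_measure_of P ?E \<le> outer_measure_of P B"
    by (rule outer_measure_of_mono) fact
  moreover have "outer_measure_of P B = ennreal (prob B)"
    using B(1) by (simp add: emeasure_eq_measure)
  moreover have "ennreal (prob B) \<le> ennreal (exp (- \<gamma> * real M))"
    using B(3) by (rule ennreal_leI)
  ultimately show ?thesis
    using B(3) by (auto intro: order_trans)
qed

end
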